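(* Let $(\mathfrak g,[\cdot,\cdot,\cdot]_{\mathfrak g})$ be a $3$-Lie algebra, $(V;\rho)$ a representation of $\mathfrak g$, $\Phi$ a $2$-cocycle on $\mathfrak g$ with coefficients in $(V;\rho)$, and let $T:V\to\mathfrak g$ be a $\Phi$-twisted Rota-Baxter operator on $\mathfrak g$ with respect to $(V;\rho)$. Then $$[u,v,w]_T=\rho(Tu,Tv)w+\rho(Tv,Tw)u+\rho(Tw,Tu)v+\Phi(Tu,Tv,Tw),\qquad u,v,w\in V,$$ defines a $3$-Lie algebra structure on $V$. Furthermore, $T$ is a homomorphism from the $3$-Lie algebra $(V,[\cdot,\cdot,\cdot]_T)$ to $(\mathfrak g,[\cdot,\cdot,\cdot]_{\mathfrak g})$.
   Context: All vector spaces are over a fixed field. A 3-Lie algebra is a vector space $\mathfrak g$ with a skew-symmetric trilinear map $[\cdot,\cdot,\cdot]_{\mathfrak g}$ (i.e. a linear map $\wedge^3\mathfrak g\to\mathfrak g$) such that for all $x_1,\dots,x_5\in\mathfrak g$: $[x_1,x_2,[x_3,x_4,x_5]_{\mathfrak g}]_{\mathfrak g}=[[x_1,x_2,x_3]_{\mathfrak g},x_4,x_5]_{\mathfrak g}+[x_3,[x_1,x_2,x_4]_{\mathfrak g},x_5]_{\mathfrak g}+[x_3,x_4,[x_1,x_2,x_5]_{\mathfrak g}]_{\mathfrak g}$. A homomorphism of 3-Lie algebras is a linear map preserving the brackets. A representation of $\mathfrak g$ is a pair $(V;\rho)$ with $V$ a vector space and $\rho:\wedge^2\mathfrak g\to\mathfrak{gl}(V)$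 linear such that for all $x_1,\dots,x_4\in\mathfrak g$: (i) $[\rho(x_1,x_2),\rho(x_3,x_4)]=\rho([x_1,x_2,x_3]_{\mathfrak g},x_4)+\rho(x_3,[x_1,x_2,x_4]_{\mathfrak g})$ (commutator on the left); (ii) $\rho([x_1,x_2,x_3]_{\mathfrak g},x_4)=\rho(x_1,x_2)\rho(x_3,x_4)+\rho(x_2,x_3)\rho(x_1,x_4)+\rho(x_3,x_1)\rho(x_2,x_4)$. A 2-cocycle on $\mathfrak g$ with coefficients in $(V;\rho)$ is a linear map $\Phi:\wedge^3\mathfrak g\to V$ such that for all $x_1,\dots,x_5\in\mathfrak g$: $\Phi(x_1,x_2,[x_3,x_4,x_5]_{\mathfrak g})-\Phi([x_1,x_2,x_3]_{\mathfrak g},x_4,x_5)-\Phi(x_3,[x_1,x_2,x_4]_{\mathfrak g},x_5)-\Phi(x_3,x_4,[x_1,x_2,x_5]_{\mathfrak g})+\rho(x_1,x_2)\Phi(x_3,x_4,x_5)-\rho(x_3,x_4)\Phi(x_1,x_2,x_5)-\rho(x_4,x_5)\Phi(x_1,x_2,x_3)-\rho(x_5,x_3)\Phi(x_1,x_2,x_4)=0$. A $\Phi$-twisted Rota-Baxter operator on $\mathfrak g$ with respect to $(V;\rho)$ is a linear map $T:V\to\mathfrak g$ with $[Tu,Tv,Tw]_{\mathfrak g}=T\big(\rho(Tu,Tv)w+\rho(Tv,Tw)u+\rho(Tw,Tu)v+\Phi(Tu,Tv,Tw)\big)$ for all $u,v,w\in V$. *)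

theory Defs
  imports Complex_Main
begin

text \<open>
  The base field is an arbitrary type of class \<open>field\<close>, of any characteristic. Vector spaces are
  given by their scalar multiplication in the sense of the locale \<open>vector_space\<close>.

  A linear map on the second or third exterior power is encoded as a bilinear or trilinear map that
  is alternating, i.e. vanishes as soon as two arguments coincide. In characteristic other than 2
  this is the same as skew-symmetry; in characteristic 2 it is stronger, and it is what factoring
  through the exterior power requires.
\<close>

definition alternating2 ::
  "('k::field \<Rightarrow> 'a::ab_group_add \<Rightarrow> 'a) \<Rightarrow> ('k \<Rightarrow> 'b::ab_group_add \<Rightarrow> 'b) \<Rightarrow> ('a \<Rightarrow> 'a \<Rightarrow> 'b) \<Rightarrow> bool"
  where
  "alternating2 s t f \<longleftrightarrow>
     (\<forall>y. Vector_Spaces.linear s t (\<lambda>x. f x y)) \<and>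
     (\<forall>x. Vector_Spaces.linear s t (\<lambda>y. f x y)) \<and>
     (\<forall>x. f x x = 0)"

definition alternating3 ::
  "('k::field \<Rightarrow> 'a::ab_group_add \<Rightarrow> 'a) \<Rightarrow> ('k \<Rightarrow> 'b::ab_group_add \<Rightarrow> 'b) \<Rightarrow>
    ('a \<Rightarrow> 'a \<Rightarrow> 'a \<Rightarrow> 'b) \<Rightarrow> bool"
  where
  "alternating3 s t f \<longleftrightarrow>
     (\<forall>y z. Vector_Spaces.linear s t (\<lambda>x. f x y z)) \<and>
     (\<forall>x z. Vector_Spaces.linear s t (\<lambda>y. f x y z)) \<and>
     (\<forall>x y. Vector_Spaces.linear s t (\<lambda>z. f x y z)) \<and>
     (\<forall>x y. f x x y = 0 \<and> f x y y = 0 \<and> f x y x = 0)"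

locale three_lie_algebra = vector_space scale
  for scale :: "'k::field \<Rightarrow> 'g::ab_group_add \<Rightarrow> 'g" +
  fixes br :: "'g \<Rightarrow> 'g \<Rightarrow> 'g \<Rightarrow> 'g"
  assumes alternating_br: "alternating3 scale scale br"
    and fundamental_identity:
      "br x1 x2 (br x3 x4 x5) =
         br (br x1 x2 x3) x4 x5 + br x3 (br x1 x2 x4) x5 + br x3 x4 (br x1 x2 x5)"

locale three_lie_hom =
  A: three_lie_algebra scaleA brA + B: three_lie_algebra scaleB brB +
  Vector_Spaces.linear scaleA scaleB f
  for scaleA :: "'k::field \<Rightarrow> 'a::ab_group_add \<Rightarrow> 'a" and brA :: "'a \<Rightarrow> 'a \<Rightarrow> 'a \<Rightarrow> 'a"
    and scaleB :: "'k \<Rightarrow> 'b::ab_group_add \<Rightarrow> 'b" and brB :: "'b \<Rightarrow> 'b \<Rightarrow> 'b \<Rightarrow> 'b"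
    and f :: "'a \<Rightarrow> 'b" +
  assumes preserves_br: "f (brA x y z) = brB (f x) (f y) (f z)"

text \<open>
  Linearity of \<open>\<rho>\<close> as a map into the endomorphisms of \<open>V\<close>, whose vector space operations are
  pointwise, is stated after evaluation at an arbitrary vector.
\<close>

locale three_lie_rep =
  g: three_lie_algebra scale br + V: vector_space scaleV
  for scale :: "'k::field \<Rightarrow> 'g::ab_group_add \<Rightarrow> 'g" and br :: "'g \<Rightarrow> 'g \<Rightarrow> 'g \<Rightarrow> 'g"
    and scaleV :: "'k \<Rightarrow> 'v::ab_group_add \<Rightarrow> 'v" +
  fixes \<rho> :: "'g \<Rightarrow> 'g \<Rightarrow> 'v \<Rightarrow> 'v"
  assumes linear_rho: "Vector_Spaces.linear scaleV scaleV (\<rho> x y)"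
    and alternating_rho: "alternating2 scale scaleV (\<lambda>x y. \<rho> x y v)"
    and rho_commutator:
      "\<rho> x1 x2 (\<rho> x3 x4 v) - \<rho> x3 x4 (\<rho> x1 x2 v) =
         \<rho> (br x1 x2 x3) x4 v + \<rho> x3 (br x1 x2 x4) v"
    and rho_br:
      "\<rho> (br x1 x2 x3) x4 v =
         \<rho> x1 x2 (\<rho> x3 x4 v) + \<rho> x2 x3 (\<rho> x1 x4 v) + \<rho> x3 x1 (\<rho> x2 x4 v)"

locale three_lie_2cocycle =
  three_lie_rep scale br scaleV \<rho>
  for scale :: "'k::field \<Rightarrow> 'g::ab_group_add \<Rightarrow> 'g" and br :: "'g \<Rightarrow> 'g \<Rightarrow> 'g \<Rightarrow> 'g"
    and scaleV :: "'k \<Rightarrow> 'v::ab_group_add \<Rightarrow> 'v" and \<rho> :: "'g \<Rightarrow> 'g \<Rightarrow> 'v \<Rightarrow> 'v" +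
  fixes \<Phi> :: "'g \<Rightarrow> 'g \<Rightarrow> 'g \<Rightarrow> 'v"
  assumes alternating_Phi: "alternating3 scale scaleV \<Phi>"
    and cocycle:
      "\<Phi> x1 x2 (br x3 x4 x5) - \<Phi> (br x1 x2 x3) x4 x5 - \<Phi> x3 (br x1 x2 x4) x5
         - \<Phi> x3 x4 (br x1 x2 x5) + \<rho> x1 x2 (\<Phi> x3 x4 x5) - \<rho> x3 x4 (\<Phi> x1 x2 x5)
         - \<rho> x4 x5 (\<Phi> x1 x2 x3) - \<rho> x5 x3 (\<Phi> x1 x2 x4) = 0"

definition twisted_bracket ::
  "('g \<Rightarrow> 'g \<Rightarrow> 'v \<Rightarrow> 'v::ab_group_add) \<Rightarrow> ('g \<Rightarrow> 'g \<Rightarrow> 'g \<Rightarrow> 'v) \<Rightarrow> ('v \<Rightarrow> 'g) \<Rightarrow> 'v \<Rightarrow> 'v \<Rightarrow> 'v \<Rightarrow> 'v"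
  where
  "twisted_bracket \<rho> \<Phi> T u v w =
     \<rho> (T u) (T v) w + \<rho> (T v) (T w) u + \<rho> (T w) (T u) v + \<Phi> (T u) (T v) (T w)"

locale twisted_rota_baxter =
  three_lie_2cocycle scale br scaleV \<rho> \<Phi> + T: Vector_Spaces.linear scaleV scale T
  for scale :: "'k::field \<Rightarrow> 'g::ab_group_add \<Rightarrow> 'g" and br :: "'g \<Rightarrow> 'g \<Rightarrow> 'g \<Rightarrow> 'g"
    and scaleV :: "'k \<Rightarrow> 'v::ab_group_add \<Rightarrow> 'v" and \<rho> :: "'g \<Rightarrow> 'g \<Rightarrow> 'v \<Rightarrow> 'v"
    and \<Phi> :: "'g \<Rightarrow> 'g \<Rightarrow> 'g \<Rightarrow> 'v" and T :: "'v \<Rightarrow> 'g" +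
  assumes rota_baxter:
    "br (T u) (T v) (T w) =
       T (\<rho> (T u) (T v) w + \<rho> (T v) (T w) u + \<rho> (T w) (T u) v + \<Phi> (T u) (T v) (T w))"

end

theory Submission
  imports Defs
begin

text \<open>
  The twisted Rota-Baxter equation says \<open>T [u, v, w]\<^sub>T = [T u, T v, T w]\<close>, so every inner bracket in
  the fundamental identity for \<open>[\<cdot>, \<cdot>, \<cdot>]\<^sub>T\<close> turns under \<open>T\<close> into a bracket of the
  given 3-Lie algebra. The identity for \<open>u\<^sub>1, \<dots>, u\<^sub>5\<close> then splits according to which \<open>u\<^sub>i\<close> the operators \<open>\<rho>\<close> act on: the terms
  in \<open>u\<^sub>3, u\<^sub>4, u\<^sub>5\<close> match by the commutator axiom of a representation, those in \<open>u\<^sub>1, u\<^sub>2\<close> by its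
  second axiom, and the remaining terms form the cocycle condition on \<open>\<Phi>\<close>.
\<close>

text \<open>Turns the locale predicate into plain equations, so that simplification can both extract
  linearity in one argument from the alternating predicates and establish it for a new map.\<close>

lemma linear_iff_add_scale:
  "Vector_Spaces.linear s t f \<longleftrightarrow>
     vector_space s \<and> vector_space t \<and>
     (\<forall>x y. f (x + y) = f x + f y) \<and> (\<forall>c x. f (s c x) = t c (f x))"
  by (auto simp: Vector_Spaces.linear_def module_hom_def module_hom_axioms_def
      vector_space_def module_def)

context three_lie_rep
begin

lemma rho_simps:
  "\<rho> x y (v + w) = \<rho> x y v + \<rho> x y w"
  "\<rho> x y (scaleV c v) = scaleV c (\<rho> x y v)"
  "\<rho> (x + x') y v = \<rho> x y v + \<rho> x' y v"
  "\<rho> (scale c x) y v = scaleV c (\<rho> x y v)"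
  "\<rho> x (y + y') v = \<rho> x y v + \<rho> x y' v"
  "\<rho> x (scale c y) v = scaleV c (\<rho> x y v)"
  "\<rho> x x v = 0"
  using linear_rho[of x y] alternating_rho[of v]
  by (simp_all add: linear_iff_add_scale alternating2_def)

lemma rho_minus: "\<rho> x y (- v) = - \<rho> x y v"
proof -
  interpret L: Vector_Spaces.linear scaleV scaleV "\<rho> x y" by (rule linear_rho)
  show ?thesis by (rule L.neg)
qed

lemma rho_skew: "\<rho> y x v = - \<rho> x y v"
proof -
  \<comment> \<open>Polarization: the two diagonal terms of the expansion vanish, in any
    characteristic.\<close>
  have "\<rho> x y v + \<rho> y x v = \<rho> (x + y) (x + y) v"
    by (simp only: rho_simps(3,5)) (simp add: rho_simps(7))
  also have "\<dots> = 0" by (rule rho_simps)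
  finally have "\<rho> x y v + \<rho> y x v = 0" .
  then show ?thesis by (simp add: eq_neg_iff_add_eq_0 add.commute)
qed

end

context three_lie_2cocycle
begin

lemma Phi_simps:
  "\<Phi> (x + x') y z = \<Phi> x y z + \<Phi> x' y z"
  "\<Phi> (scale c x) y z = scaleV c (\<Phi> x y z)"
  "\<Phi> x (y + y') z = \<Phi> x y z + \<Phi> x y' z"
  "\<Phi> x (scale c y) z = scaleV c (\<Phi> x y z)"
  "\<Phi> x y (z + z') = \<Phi> x y z + \<Phi> x y z'"
  "\<Phi> x y (scale c z) = scaleV c (\<Phi> x y z)"
  "\<Phi> x x y = 0" "\<Phi> x y y = 0" "\<Phi> x y x = 0"
  using alternating_Phi by (simp_all add: linear_iff_add_scale alternating3_def)

end

context twisted_rota_baxter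
begin

abbreviation br_T :: "'v \<Rightarrow> 'v \<Rightarrow> 'v \<Rightarrow> 'v" where
  "br_T \<equiv> twisted_bracket \<rho> \<Phi> T"

lemma T_br_T: "T (br_T u v w) = br (T u) (T v) (T w)"
  by (simp add: twisted_bracket_def rota_baxter)

lemma alternating_br_T: "alternating3 scaleV scaleV br_T"
proof -
  \<comment> \<open>With two equal arguments, one \<open>\<rho>\<close> term and the
    \<open>\<Phi>\<close> term vanish, and the other two \<open>\<rho>\<close> terms cancel by
    skew-symmetry.\<close>
  have "br_T u u w = 0" "br_T u w w = 0" "br_T u w u = 0" for u w
    by (simp_all add: twisted_bracket_def rho_simps Phi_simps rho_skew[of "T u" "T w"])
  then show ?thesis
    unfolding alternating3_def linear_iff_add_scale
    by (simp add: twisted_bracket_def T.add T.scale rho_simps Phi_simps V.scale_right_distrib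
        V.vector_space_axioms add_ac)
qed

lemma fundamental_identity_br_T:
  "br_T u1 u2 (br_T u3 u4 u5) =
     br_T (br_T u1 u2 u3) u4 u5 + br_T u3 (br_T u1 u2 u4) u5 + br_T u3 u4 (br_T u1 u2 u5)"
proof -
  define x1 x2 x3 x4 x5 where x: "x1 = T u1" "x2 = T u2" "x3 = T u3" "x4 = T u4" "x5 = T u5"
  have outer: "br_T u v w =
      \<rho> (T u) (T v) w + \<rho> (T v) (T w) u + \<rho> (T w) (T u) v + \<Phi> (T u) (T v) (T w)"
    for u v w by (simp add: twisted_bracket_def)
  have on_u5: "\<rho> x1 x2 (\<rho> x3 x4 u5) =
      \<rho> (br x1 x2 x3) x4 u5 + \<rho> x3 (br x1 x2 x4) u5 + \<rho> x3 x4 (\<rho> x1 x2 u5)"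
    using rho_commutator[of x1 x2 x3 x4 u5] by (simp add: diff_eq_eq)
  have on_u3: "\<rho> x1 x2 (\<rho> x4 x5 u3) =
      \<rho> (br x1 x2 x4) x5 u3 + \<rho> x4 (br x1 x2 x5) u3 + \<rho> x4 x5 (\<rho> x1 x2 u3)"
    using rho_commutator[of x1 x2 x4 x5 u3] by (simp add: diff_eq_eq)
  \<comment> \<open>The order \<open>x5 x3\<close> is the cyclic one of the bracket, so no signs
    arise.\<close>
  have on_u4: "\<rho> x1 x2 (\<rho> x5 x3 u4) =
      \<rho> (br x1 x2 x5) x3 u4 + \<rho> x5 (br x1 x2 x3) u4 + \<rho> x5 x3 (\<rho> x1 x2 u4)"
    using rho_commutator[of x1 x2 x5 x3 u4] by (simp add: diff_eq_eq)
  \<comment> \<open>\<open>rho_br\<close> wants the bracket in the first slot. Moving it there costs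
    a sign, which swapping the arguments of each inner \<open>\<rho>\<close> undoes.\<close>
  have on_u1: "\<rho> x2 (br x3 x4 x5) u1 =
      \<rho> x3 x4 (\<rho> x2 x5 u1) + \<rho> x4 x5 (\<rho> x2 x3 u1) + \<rho> x5 x3 (\<rho> x2 x4 u1)"
    using rho_br[of x3 x4 x5 x2 u1]
    by (simp add: rho_skew[of x2 "br x3 x4 x5"] rho_skew[of x2 x3] rho_skew[of x2 x4]
        rho_skew[of x2 x5] rho_minus)
  have on_u2: "\<rho> (br x3 x4 x5) x1 u2 =
      \<rho> x3 x4 (\<rho> x5 x1 u2) + \<rho> x4 x5 (\<rho> x3 x1 u2) + \<rho> x5 x3 (\<rho> x4 x1 u2)"
    by (rule rho_br)
  have no_u: "\<Phi> x1 x2 (br x3 x4 x5) + \<rho> x1 x2 (\<Phi> x3 x4 x5) =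
      \<Phi> (br x1 x2 x3) x4 x5 + \<Phi> x3 (br x1 x2 x4) x5 + \<Phi> x3 x4 (br x1 x2 x5)
      + \<rho> x3 x4 (\<Phi> x1 x2 x5) + \<rho> x4 x5 (\<Phi> x1 x2 x3) + \<rho> x5 x3 (\<Phi> x1 x2 x4)"
    using cocycle[of x1 x2 x3 x4 x5] by (simp add: algebra_simps)
  \<comment> \<open>Grouped so that each summand is the left side of one of the six equations
    above.\<close>
  have "br_T u1 u2 (br_T u3 u4 u5) =
      \<rho> x1 x2 (\<rho> x3 x4 u5) + \<rho> x1 x2 (\<rho> x4 x5 u3) + \<rho> x1 x2 (\<rho> x5 x3 u4)
      + \<rho> x2 (br x3 x4 x5) u1 + \<rho> (br x3 x4 x5) x1 u2
      + (\<Phi> x1 x2 (br x3 x4 x5) + \<rho> x1 x2 (\<Phi> x3 x4 x5))"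
    \<comment> \<open>Only the outermost bracket is expanded at first: the inner one must stay
      intact under \<open>T\<close> for \<open>T_br_T\<close> to apply.\<close>
    unfolding outer[of u1 u2] T_br_T
    by (simp add: outer rho_simps x add_ac)
  also have "\<dots> =
      br_T (br_T u1 u2 u3) u4 u5 + br_T u3 (br_T u1 u2 u4) u5 + br_T u3 u4 (br_T u1 u2 u5)"
    unfolding on_u1 on_u2 on_u3 on_u4 on_u5 no_u outer[of _ u4 u5] outer[of u3 _ u5]
      outer[of u3 u4] T_br_T
    by (simp add: outer rho_simps x add_ac)
  finally show ?thesis .
qed

lemma three_lie_algebra_br_T: "three_lie_algebra scaleV br_T"
  by (intro three_lie_algebra.intro three_lie_algebra_axioms.intro V.vector_space_axioms
      alternating_br_T fundamental_identity_br_T)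

lemma three_lie_hom_T: "three_lie_hom scaleV br_T scale br T"
  by (intro three_lie_hom.intro three_lie_hom_axioms.intro three_lie_algebra_br_T
      g.three_lie_algebra_axioms T.linear_axioms T_br_T)

end

theorem corollary2p9:
  fixes scale :: "'k::field \<Rightarrow> 'g::ab_group_add \<Rightarrow> 'g" and br :: "'g \<Rightarrow> 'g \<Rightarrow> 'g \<Rightarrow> 'g"
    and scaleV :: "'k \<Rightarrow> 'v::ab_group_add \<Rightarrow> 'v" and \<rho> :: "'g \<Rightarrow> 'g \<Rightarrow> 'v \<Rightarrow> 'v"
    and \<Phi> :: "'g \<Rightarrow> 'g \<Rightarrow> 'g \<Rightarrow> 'v" and T :: "'v \<Rightarrow> 'g"
  assumes "three_lie_algebra scale br"
    and "three_lie_rep scale br scaleV \<rho>"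
    and "three_lie_2cocycle scale br scaleV \<rho> \<Phi>"
    and "twisted_rota_baxter scale br scaleV \<rho> \<Phi> T"
  shows "three_lie_algebra scaleV (twisted_bracket \<rho> \<Phi> T) \<and>
         three_lie_hom scaleV (twisted_bracket \<rho> \<Phi> T) scale br T"
  using assms(4) twisted_rota_baxter.three_lie_algebra_br_T twisted_rota_baxter.three_lie_hom_T
  by blast

end
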